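(* Let $F=f+g$ satisfy Assumption 1 (i) and (ii) given in the context, and let $(x_k)_{k\ge 0}$ be a sequence generated by the RCCM algorithm described in the context; assume that it is bounded. Assume additionally that $F$ satisfies the KL property given in the context (with compact set $\mathcal{X}$, value $F_*$, and constants $\gamma,\epsilon,\sigma_q>0$, $q>1$), and that there exists $k_0\ge 0$ such that for every $k\ge k_0$ the iterate $x_k$ belongs to the KL neighborhood, i.e. $\mathrm{dist}(x_k,\mathcal{X})\le\gamma$ and $F_*<F(x_k)<F_*+\epsilon$. Then there exists a constant $C>0$, independent of $k$, with $\min_{s_{k+1}\in\partial F(x_{k+1})}\|s_{k+1}\|\le C\|x_{k+1}-x_k\|$ for all $k\ge 0$, and for this $C$ and every $k\ge k_0$ we have $$F(x_{k+1})-F^*\ \le\ (F(x_k)-F^* )-\frac{M_{\min}}{2C^2}\left(\frac{F(x_{k+1})-F_*}{\sigma_q}\right)^{2/q}.$$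
   Context: Blocks. Let $n=\sum_{i=1}^N n_i$, let $E=[E_1,\dots,E_N]$ be a column permutation of the $n\times n$ identity matrix partitioned into $E_i\in\mathbb{R}^{n\times n_i}$; for $x\in\mathbb{R}^n$ put $x^{(i)}=E_i^Tx\in\mathbb{R}^{n_i}$, so $x=\sum_i E_i x^{(i)}$, also written $x=(x^{(1)},\dots,x^{(N)})$. $\|\cdot\|$ is the Euclidean norm and $\mathrm{dist}$ the Euclidean distance to a set. $\partial F$ is the limiting subdifferential. Problem. $F^*=\min_{x\in\mathbb{R}^n}F(x)$, $F(x):=f(x)+g(x)$, with $f:\mathbb{R}^n\to\mathbb{R}$ and $g:\mathbb{R}^n\to(-\infty,+\infty]$, both possibly nonconvex. Assumption 1. (i) $f$ is twice continuously differentiable; $g$ is proper, lower semicontinuous and separable, $g(x)=\sum_{i=1}^N g_i(x^{(i)})$; and for every $i$ and every fixed $\hat y=(y^{(1)},\dots,y^{(i-1)},y^{(i+1)},\dots,y^{(N)})$ one has $\inf_{x^{(i)}\in\mathbb{R}^{n_i}} f(x^{(i)},\hat y)+g_i(x^{(i)})>-\infty$, where $f(x^{(i)},\hat y)$ is the value of $f$ at the vector whose $i$-th block is $x^{(i)}$ and whose other blocks are those of $\hat y$. (ii) The problem has a solution (hence $F^*>-\infty$). RCCM (Regularized Cyclic Coordinate Minimization) algorithm. Given regularization parameters $M_i\ge 0$, $i=1,\dots,N$, and $x_0\in\mathrm{dom}\,g$, for $k=0,1,2,\dots$ and, within each $k$, successively for $i=1,\dots,N$, choose $$x_{k+1}^{(i)}\in\arg\min_{x^{(i)}\in\mathbb{R}^{n_i}}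 f(x^{(i)},\hat x_{k,i})+g_i(x^{(i)})+\frac{M_i}{2}\|x^{(i)}-x_k^{(i)}\|^2,$$ where $\hat x_{k,i}=(x_{k+1}^{(1)},\dots,x_{k+1}^{(i-1)},x_k^{(i+1)},\dots,x_k^{(N)})$; then set $x_{k+1}=(x_{k+1}^{(1)},\dots,x_{k+1}^{(N)})$. $M_{\min}=\min(M_1,\dots,M_N)$. KL property. Let $\mathcal{X}$ be a given (nonempty) compact set on which $F$ takes a constant value $F_*$, and let $\sigma_q>0$, $q>1$. $F$ satisfies the KL property if there exist $\gamma,\epsilon>0$ such that for all $x$ with $\mathrm{dist}(x,\mathcal{X})\le\gamma$ and $F_*<F(x)<F_*+\epsilon$, $$F(x)-F_*\le\sigma_q\,\mathrm{dist}(0,\partial F(x))^q.$$ *)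

theory Defs
  imports "HOL-Analysis.Analysis"
begin

text \<open>
  Blocks are indexed by \<open>{1..N}\<close> and the \<open>i\<close>-th block space, of dimension \<open>d i\<close>, is modelled by the
  extensional functions on \<open>{1..d i}\<close>, since the block dimensions vary with \<open>i\<close>. The matrix \<open>E\<^sub>i\<close> is
  given by its columns \<open>E i 1, \<dots>, E i (d i)\<close>.
\<close>

definition block_space :: "nat \<Rightarrow> (nat \<Rightarrow> real) set" where
  "block_space m = {1..m} \<rightarrow>\<^sub>E UNIV"

text \<open>
  Being in bijection with the columns of the identity forces the block dimensions to add up to the
  dimension of the whole space.
\<close>

definition block_partition ::
  "nat \<Rightarrow> (nat \<Rightarrow> nat) \<Rightarrow> (nat \<Rightarrow> nat \<Rightarrow> real ^ 'n) \<Rightarrow> bool" where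
  "block_partition N d E \<longleftrightarrow>
     bij_betw (\<lambda>(i, j). E i j) (SIGMA i:{1..N}. {1..d i}) (columns (mat 1 :: real ^ 'n ^ 'n))"

text \<open>\<open>E\<^sub>i\<^sup>T x\<close> and \<open>\<Sum>\<^sub>i E\<^sub>i x\<^sup>(\<^sup>i\<^sup>)\<close>, respectively:\<close>

definition block ::
  "(nat \<Rightarrow> nat) \<Rightarrow> (nat \<Rightarrow> nat \<Rightarrow> real ^ 'n) \<Rightarrow> real ^ 'n \<Rightarrow> nat \<Rightarrow> (nat \<Rightarrow> real)" where
  "block d E x i = (\<lambda>j\<in>{1..d i}. E i j \<bullet> x)"

definition assemble ::
  "nat \<Rightarrow> (nat \<Rightarrow> nat) \<Rightarrow> (nat \<Rightarrow> nat \<Rightarrow> real ^ 'n) \<Rightarrow> (nat \<Rightarrow> nat \<Rightarrow> real) \<Rightarrow> real ^ 'n" where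
  "assemble N d E z = (\<Sum>i=1..N. \<Sum>j=1..d i. z i j *\<^sub>R E i j)"

definition twice_continuously_differentiable :: "(real ^ 'n \<Rightarrow> real) \<Rightarrow> bool" where
  "twice_continuously_differentiable f \<longleftrightarrow>
     (\<exists>(G :: real ^ 'n \<Rightarrow> real ^ 'n) (H :: real ^ 'n \<Rightarrow> real ^ 'n ^ 'n).
        (\<forall>x. (f has_derivative (\<lambda>h. G x \<bullet> h)) (at x)) \<and>
        (\<forall>x. (G has_derivative (\<lambda>h. H x *v h)) (at x)) \<and>
        continuous_on UNIV H)"

definition proper :: "('a \<Rightarrow> ereal) \<Rightarrow> bool" where
  "proper g \<longleftrightarrow> (\<forall>x. g x \<noteq> - \<infinity>) \<and> (\<exists>x. g x \<noteq> \<infinity>)"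

definition lower_semicontinuous :: "('a::topological_space \<Rightarrow> ereal) \<Rightarrow> bool" where
  "lower_semicontinuous g \<longleftrightarrow> (\<forall>x. g x \<le> Liminf (at x) g)"

definition frechet_subdifferential :: "('a::real_inner \<Rightarrow> ereal) \<Rightarrow> 'a \<Rightarrow> 'a set" where
  "frechet_subdifferential F x =
     {v. \<bar>F x\<bar> \<noteq> \<infinity> \<and>
         0 \<le> Liminf (at x) (\<lambda>y. (F y - F x - ereal (v \<bullet> (y - x))) / ereal (norm (y - x)))}"

definition limiting_subdifferential :: "('a::real_inner \<Rightarrow> ereal) \<Rightarrow> 'a \<Rightarrow> 'a set" where
  "limiting_subdifferential F x =
     {v. \<bar>F x\<bar> \<noteq> \<infinity> \<and>
         (\<exists>xs vs. xs \<longlonglongrightarrow> x \<and> (\<lambda>m. F (xs m)) \<longlonglongrightarrow> F x \<and>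
                  (\<forall>m. vs m \<in> frechet_subdifferential F (xs m)) \<and> vs \<longlonglongrightarrow> v)}"

definition composite :: "('a \<Rightarrow> real) \<Rightarrow> ('a \<Rightarrow> ereal) \<Rightarrow> 'a \<Rightarrow> ereal" where
  "composite f g x = ereal (f x) + g x"

text \<open>
  In the lower boundedness condition, the \<open>i\<close>-th block of \<open>y\<close> is overwritten by \<open>u\<close>, so only the
  other blocks of \<open>y\<close> matter.
\<close>

definition structure_assumption ::
  "nat \<Rightarrow> (nat \<Rightarrow> nat) \<Rightarrow> (nat \<Rightarrow> nat \<Rightarrow> real ^ 'n) \<Rightarrow> (real ^ 'n \<Rightarrow> real) \<Rightarrow>
   (real ^ 'n \<Rightarrow> ereal) \<Rightarrow> (nat \<Rightarrow> (nat \<Rightarrow> real) \<Rightarrow> ereal) \<Rightarrow> bool" where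
  "structure_assumption N d E f g gs \<longleftrightarrow>
     twice_continuously_differentiable f \<and>
     proper g \<and> lower_semicontinuous g \<and>
     (\<forall>i\<in>{1..N}. \<forall>u\<in>block_space (d i). gs i u \<noteq> - \<infinity>) \<and>
     (\<forall>x. g x = (\<Sum>i=1..N. gs i (block d E x i))) \<and>
     (\<forall>i\<in>{1..N}. \<forall>y.
        (INF u\<in>block_space (d i). ereal (f (assemble N d E ((block d E y)(i := u)))) + gs i u)
          > - \<infinity>)"

definition has_minimizer :: "('a \<Rightarrow> ereal) \<Rightarrow> bool" where
  "has_minimizer F \<longleftrightarrow> (\<exists>z. is_arg_min F (\<lambda>_. True) z)"

definition rccm ::
  "nat \<Rightarrow> (nat \<Rightarrow> nat) \<Rightarrow> (nat \<Rightarrow> nat \<Rightarrow> real ^ 'n) \<Rightarrow> (real ^ 'n \<Rightarrow> real) \<Rightarrow>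
   (real ^ 'n \<Rightarrow> ereal) \<Rightarrow> (nat \<Rightarrow> (nat \<Rightarrow> real) \<Rightarrow> ereal) \<Rightarrow> (nat \<Rightarrow> real) \<Rightarrow>
   (nat \<Rightarrow> real ^ 'n) \<Rightarrow> bool" where
  "rccm N d E f g gs M x \<longleftrightarrow>
     (\<forall>i\<in>{1..N}. M i \<ge> 0) \<and>
     g (x 0) < \<infinity> \<and>
     (\<forall>k. \<forall>i\<in>{1..N}.
        is_arg_min
          (\<lambda>u. ereal (f (assemble N d E
                  (\<lambda>j. if j < i then block d E (x (Suc k)) j
                       else if j = i then u
                       else block d E (x k) j)))
               + gs i u
               + ereal (M i / 2 * (L2_set (\<lambda>j. u j - block d E (x k) i j) {1..d i})\<^sup>2))
          (\<lambda>u. u \<in> block_space (d i))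
          (block d E (x (Suc k)) i))"

text \<open>
  The distance to an empty subdifferential is \<open>+\<infinity>\<close>, so the inequality is vacuous there;
  \<^const>\<open>infdist\<close> would give 0 instead, hence the explicit guard.
\<close>

definition KL_property ::
  "('a::real_inner \<Rightarrow> ereal) \<Rightarrow> 'a set \<Rightarrow> real \<Rightarrow> real \<Rightarrow> real \<Rightarrow> real \<Rightarrow> real \<Rightarrow> bool" where
  "KL_property F X Fs \<sigma> q \<gamma> \<epsilon> \<longleftrightarrow>
     (\<forall>x. infdist x X \<le> \<gamma> \<and> ereal Fs < F x \<and> F x < ereal (Fs + \<epsilon>) \<longrightarrow>
        limiting_subdifferential F x \<noteq> {} \<longrightarrow>
        F x - ereal Fs \<le> ereal (\<sigma> * infdist 0 (limiting_subdifferential F x) powr q))"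

end

theory Submission
  imports Defs
begin

text \<open>
  Let \<open>P\<^sub>i\<close> be the orthogonal projection onto the \<open>i\<close>-th block and \<open>z\<^sub>i\<close> the point whose first
  \<open>i\<close> blocks are those of the new iterate \<open>x'\<close>, the others those of \<open>x\<close>. Comparing the \<open>i\<close>-th block
  minimizer with the old block and telescoping over \<open>i\<close> gives the descent
  \<open>F x' + M\<^sub>m\<^sub>i\<^sub>n / 2 * \<parallel>x' - x\<parallel>\<^sup>2 \<le> F x\<close>. Comparing it with an arbitrary block instead bounds each
  \<open>g\<^sub>i\<close> from below by a function that is smooth and exact at \<open>x'\<close>; adding these bounds yields a
  smooth minorant of \<open>F\<close> touching at \<open>x'\<close>, so its gradient
  \<open>\<Sum>\<^sub>i P\<^sub>i (\<nabla>f x' - \<nabla>f z\<^sub>i - M\<^sub>i (x' - x))\<close> is a Frechet subgradient there, of norm at most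
  \<open>C * \<parallel>x' - x\<parallel>\<close> because \<open>\<nabla>f\<close> is Lipschitz on bounded sets. The KL inequality then bounds
  \<open>\<parallel>x' - x\<parallel>\<close> from below in the descent estimate.
\<close>

section \<open>Subgradients, and a Lipschitz bound for the gradient on balls\<close>

lemma closed_limiting_subdifferential:
  fixes F :: "'a::euclidean_space \<Rightarrow> ereal"
  shows "closed (limiting_subdifferential F x)"
proof (cases "\<bar>F x\<bar> = \<infinity>")
  case True
  then show ?thesis by (simp add: limiting_subdifferential_def)
next
  case False
  \<comment> \<open>The limiting subdifferential is a section of the closure of the graph of the Frechet one.\<close>
  define S where "S = {(y, F y, w) |y w. w \<in> frechet_subdifferential F y}"
  have "v \<in> limiting_subdifferential F x \<longleftrightarrow> (x, F x, v) \<in> closure S" for v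
  proof
    assume "v \<in> limiting_subdifferential F x"
    then obtain xs vs where *: "xs \<longlonglongrightarrow> x" "(\<lambda>m. F (xs m)) \<longlonglongrightarrow> F x"
      "\<And>m. vs m \<in> frechet_subdifferential F (xs m)" "vs \<longlonglongrightarrow> v"
      by (auto simp: limiting_subdifferential_def)
    then have "(\<lambda>m. (xs m, F (xs m), vs m)) \<longlonglongrightarrow> (x, F x, v)"
      by (intro tendsto_Pair)
    moreover have "\<forall>m. (xs m, F (xs m), vs m) \<in> S"
      using * by (auto simp: S_def)
    ultimately show "(x, F x, v) \<in> closure S"
      unfolding closure_sequential by (intro exI[of _ "\<lambda>m. (xs m, F (xs m), vs m)"]) simp
  next
    assume "(x, F x, v) \<in> closure S"
    then obtain t where t: "\<And>m. t m \<in> S" "t \<longlonglongrightarrow> (x, F x, v)"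
      unfolding closure_sequential by blast
    have "fst (snd (t m)) = F (fst (t m))"
      "snd (snd (t m)) \<in> frechet_subdifferential F (fst (t m))" for m
      using t(1)[of m] by (auto simp: S_def)
    moreover have "(\<lambda>m. fst (t m)) \<longlonglongrightarrow> x" "(\<lambda>m. fst (snd (t m))) \<longlonglongrightarrow> F x"
      "(\<lambda>m. snd (snd (t m))) \<longlonglongrightarrow> v"
      using tendsto_fst[OF t(2)] tendsto_fst[OF tendsto_snd[OF t(2)]]
        tendsto_snd[OF tendsto_snd[OF t(2)]] by simp_all
    ultimately show "v \<in> limiting_subdifferential F x"
      using False unfolding limiting_subdifferential_def
      by (intro CollectI conjI exI[of _ "\<lambda>m. fst (t m)"] exI[of _ "\<lambda>m. snd (snd (t m))"]) auto
  qed
  then have "limiting_subdifferential F x = (\<lambda>v. (x, F x, v)) -` closure S"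
    by auto
  then show ?thesis
    by (simp add: closed_vimage continuous_on_Pair)
qed

lemma frechet_subset_limiting_subdifferential:
  "frechet_subdifferential F x \<subseteq> limiting_subdifferential F x"
proof
  fix v assume "v \<in> frechet_subdifferential F x"
  then show "v \<in> limiting_subdifferential F x"
    unfolding limiting_subdifferential_def
    by (intro CollectI conjI exI[of _ "\<lambda>_. x"] exI[of _ "\<lambda>_. v"])
      (auto simp: frechet_subdifferential_def)
qed

text \<open>The difference quotient of \<open>F\<close> dominates that of \<open>\<psi>\<close>,
  which tends to 0 by differentiability, and \<open>Liminf\<close> is monotone. This produces
  subgradients of \<open>F\<close> without a sum rule for \<open>f\<close> and
  \<open>g\<close>.\<close>

lemma frechet_subgradient_of_minorant:
  fixes F :: "'a::euclidean_space \<Rightarrow> ereal" and \<psi> :: "'a \<Rightarrow> real"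
  assumes fin: "\<bar>F x\<bar> \<noteq> \<infinity>"
    and le: "\<And>y. F x + ereal (\<psi> y) \<le> F y"
    and zero: "\<psi> x = 0"
    and deriv: "(\<psi> has_derivative (\<lambda>h. v \<bullet> h)) (at x)"
  shows "v \<in> frechet_subdifferential F x"
proof -
  let ?r = "\<lambda>y. (\<psi> y - v \<bullet> (y - x)) / norm (y - x)"
  have "(?r \<longlongrightarrow> 0) (at x)"
    by (rule tendsto_norm_zero_cancel) (use deriv zero in \<open>simp add: has_derivative_iff_norm\<close>)
  then have "((\<lambda>y. ereal (?r y)) \<longlongrightarrow> ereal 0) (at x)"
    by simp
  then have "Liminf (at x) (\<lambda>y. ereal (?r y)) = 0"
    by (subst lim_imp_Liminf) (auto simp: zero_ereal_def)
  \<comment> \<open>\<open>F y\<close> may be \<open>\<infinity>\<close>, where the quotient is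
    infinite; \<open>le\<close> and the finiteness of \<open>F x\<close> rule out
    \<open>- \<infinity>\<close>.\<close>
  moreover have "ereal (?r y) \<le> (F y - F x - ereal (v \<bullet> (y - x))) / ereal (norm (y - x))"
    if "y \<noteq> x" for y
    using le[of y] fin that
    by (cases "F x"; cases "F y") (auto simp: divide_right_mono)
  then have "Liminf (at x) (\<lambda>y. ereal (?r y)) \<le>
      Liminf (at x) (\<lambda>y. (F y - F x - ereal (v \<bullet> (y - x))) / ereal (norm (y - x)))"
    by (intro Liminf_mono) (auto simp: eventually_at_filter)
  ultimately show ?thesis
    using fin by (simp add: frechet_subdifferential_def)
qed

text \<open>A continuous Hessian is bounded on a compact ball, and the ball is convex, so the mean
  value inequality applies.\<close>

lemma lipschitz_gradient_on_cball:
  fixes G :: "real ^ 'n \<Rightarrow> real ^ 'n" and H :: "real ^ 'n \<Rightarrow> real ^ 'n ^ 'n"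
  assumes "\<And>x. (G has_derivative (\<lambda>h. H x *v h)) (at x)" and "continuous_on UNIV H"
  obtains L where "L \<ge> 0"
    and "\<And>y z. \<lbrakk>norm y \<le> R; norm z \<le> R\<rbrakk> \<Longrightarrow> norm (G y - G z) \<le> L * norm (y - z)"
proof -
  have "bounded (H ` cball 0 R)"
    by (intro compact_imp_bounded compact_continuous_image continuous_on_subset[OF assms(2)]) auto
  then obtain B where B: "B > 0" "\<And>x. norm x \<le> R \<Longrightarrow> norm (H x) \<le> B"
    by (auto simp: bounded_pos)
  \<comment> \<open>A bound \<open>B\<close> on all entries of an \<open>n\<close> by
    \<open>n\<close> matrix bounds its operator norm by \<open>n * n * B\<close>.\<close>
  define L where "L = real CARD('n) * real CARD('n) * B"
  have "onorm (\<lambda>h. H x *v h) \<le> L" if "x \<in> cball 0 R" for x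
    unfolding L_def
  proof (rule onorm_le_matrix_component)
    fix i j
    have "\<bar>H x $ i $ j\<bar> \<le> norm (H x $ i)" by (rule component_le_norm_cart)
    also have "\<dots> \<le> norm (H x)" by (rule Finite_Cartesian_Product.norm_nth_le)
    finally show "\<bar>H x $ i $ j\<bar> \<le> B" using B(2)[of x] that by simp
  qed
  then have "norm (G y - G z) \<le> L * norm (y - z)" if "norm y \<le> R" "norm z \<le> R" for y z
    using that
    by (intro differentiable_bound[where S = "cball 0 R" and f' = "\<lambda>x h. H x *v h"]
        has_derivative_at_withinI[OF assms(1)]) auto
  moreover have "L \<ge> 0" using B by (simp add: L_def)
  ultimately show ?thesis using that by blast
qed

section \<open>Orthogonal projections onto the blocks\<close>

lemma columns_mat_1: "columns (mat 1 :: real ^ 'n ^ 'n) = Basis"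
proof -
  have "column k (mat 1 :: real ^ 'n ^ 'n) = axis k 1" for k
    by (simp add: column_def mat_def axis_def vec_eq_iff)
  then show ?thesis by (auto simp: columns_def Basis_vec_def)
qed

text \<open>This is \<open>E\<^sub>i E\<^sub>i\<^sup>T\<close>. It keeps blocks of different
  dimensions inside the one space \<open>real ^ 'n\<close>, where derivatives and norms are
  available.\<close>

definition block_proj ::
  "(nat \<Rightarrow> nat) \<Rightarrow> (nat \<Rightarrow> nat \<Rightarrow> real ^ 'n) \<Rightarrow> nat \<Rightarrow> real ^ 'n \<Rightarrow> real ^ 'n" where
  "block_proj d E i w = (\<Sum>j=1..d i. (E i j \<bullet> w) *\<^sub>R E i j)"

lemma linear_block_proj: "linear (block_proj d E i)"
  unfolding block_proj_def
  by (rule linearI)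
    (simp_all add: inner_add_right scaleR_add_left sum.distrib scaleR_sum_right)

lemma block_proj_inner: "block_proj d E i w \<bullet> v = w \<bullet> block_proj d E i v"
  by (simp add: block_proj_def inner_sum_left inner_sum_right inner_commute mult.commute)

lemma block_in_block_space: "block d E y i \<in> block_space (d i)"
  by (simp add: block_def block_space_def)

locale partitioned_space =
  fixes N :: nat and d :: "nat \<Rightarrow> nat" and E :: "nat \<Rightarrow> nat \<Rightarrow> real ^ 'n"
  assumes partition: "block_partition N d E"
begin

abbreviation P :: "nat \<Rightarrow> real ^ 'n \<Rightarrow> real ^ 'n" where
  "P \<equiv> block_proj d E"

lemmas proj_diff = linear_diff[OF linear_block_proj, of d E]

lemma bij_Basis: "bij_betw (\<lambda>(i, j). E i j) (SIGMA i:{1..N}. {1..d i}) Basis"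
  using partition by (simp add: block_partition_def columns_mat_1)

text \<open>The columns \<open>E i j\<close> run through the standard basis exactly once, so the
  double sum is the coordinate expansion of \<open>w\<close>.\<close>

lemma sum_proj: "(\<Sum>i=1..N. P i w) = w"
proof -
  have "(\<Sum>i=1..N. P i w) = (\<Sum>p\<in>(SIGMA i:{1..N}. {1..d i}).
      ((case p of (i, j) \<Rightarrow> E i j) \<bullet> w) *\<^sub>R (case p of (i, j) \<Rightarrow> E i j))"
    unfolding block_proj_def by (subst sum.Sigma) (auto intro: sum.cong)
  also have "\<dots> = (\<Sum>b\<in>Basis. (b \<bullet> w) *\<^sub>R b)"
    by (rule sum.reindex_bij_betw[OF bij_Basis])
  also have "\<dots> = w"
    by (subst inner_commute) (rule euclidean_representation)
  finally show ?thesis .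
qed

lemma inner_E:
  assumes "i \<in> {1..N}" "j \<in> {1..d i}" "j' \<in> {1..d i}"
  shows "E i j \<bullet> E i j' = (if j = j' then 1 else 0)"
proof -
  have "E i j \<in> Basis" "E i j' \<in> Basis"
    using assms bij_betw_apply[OF bij_Basis, of "(i, j)"] bij_betw_apply[OF bij_Basis, of "(i, j')"]
    by auto
  moreover have "E i j = E i j' \<longleftrightarrow> j = j'"
    using assms inj_onD[OF bij_betw_imp_inj_on[OF bij_Basis], of "(i, j)" "(i, j')"] by auto
  ultimately show ?thesis by (simp add: inner_Basis)
qed

lemma proj_idem:
  assumes "i \<in> {1..N}"
  shows "P i (P i w) = P i w"
proof -
  have "E i j \<bullet> P i w = E i j \<bullet> w" if "j \<in> {1..d i}" for j
  proof -
    have "E i j \<bullet> P i w = (\<Sum>j'=1..d i. if j = j' then E i j' \<bullet> w else 0)"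
      unfolding block_proj_def inner_sum_right
      using that assms by (intro sum.cong) (simp_all add: inner_E)
    then show ?thesis using that by simp
  qed
  then have "(\<Sum>j=1..d i. (E i j \<bullet> P i w) *\<^sub>R E i j) = (\<Sum>j=1..d i. (E i j \<bullet> w) *\<^sub>R E i j)"
    by (intro sum.cong) simp_all
  then show ?thesis by (simp only: block_proj_def)
qed

lemma norm_proj_squared:
  assumes "i \<in> {1..N}"
  shows "(norm (P i w))\<^sup>2 = P i w \<bullet> w"
  by (simp add: power2_norm_eq_inner block_proj_inner proj_idem[OF assms])

lemma norm_proj_le:
  assumes "i \<in> {1..N}"
  shows "norm (P i w) \<le> norm w"
proof -
  have "norm (P i w) * norm (P i w) \<le> norm (P i w) * norm w"
    using norm_cauchy_schwarz[of "P i w" w] norm_proj_squared[OF assms, of w]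
    by (simp add: power2_eq_square)
  then show ?thesis by (cases "P i w = 0") auto
qed

text \<open>Pythagoras for the blocks, from self-adjointness and idempotence; it merges the proximal
  terms of one sweep into a single norm.\<close>

lemma sum_norm_proj_squared: "(\<Sum>i=1..N. (norm (P i w))\<^sup>2) = (norm w)\<^sup>2"
proof -
  have "(\<Sum>i=1..N. (norm (P i w))\<^sup>2) = (\<Sum>i=1..N. P i w) \<bullet> w"
    unfolding inner_sum_left by (intro sum.cong) (simp_all add: norm_proj_squared)
  then show ?thesis by (simp only: sum_proj power2_norm_eq_inner)
qed

text \<open>Translates the proximal term of \<open>rccm\<close> from coordinates to
  projections.\<close>

lemma L2_set_block_diff:
  assumes "i \<in> {1..N}"
  shows "(L2_set (\<lambda>j. block d E y i j - block d E x i j) {1..d i})\<^sup>2 = (norm (P i (y - x)))\<^sup>2"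
proof -
  have "(L2_set (\<lambda>j. block d E y i j - block d E x i j) {1..d i})\<^sup>2
      = (\<Sum>j=1..d i. (E i j \<bullet> (y - x))\<^sup>2)"
    by (auto simp: L2_set_def sum_nonneg block_def inner_diff_right intro!: sum.cong)
  also have "\<dots> = P i (y - x) \<bullet> (y - x)"
    by (simp add: block_proj_def inner_sum_left power2_eq_square)
  finally show ?thesis by (simp only: norm_proj_squared[OF assms])
qed

text \<open>Triangle inequality with contractive projections; the crude factor \<open>N\<close>
  suffices, since \<open>C\<close> only has to exist.\<close>

lemma norm_sum_proj_le:
  assumes "\<And>i. i \<in> {1..N} \<Longrightarrow> norm (w i) \<le> b"
  shows "norm (\<Sum>i=1..N. P i (w i)) \<le> real N * b"
proof -
  have "norm (\<Sum>i=1..N. P i (w i)) \<le> of_nat (card {1..N}) * b"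
    using assms by (intro sum_norm_bound) (meson norm_proj_le order_trans)
  then show ?thesis by simp
qed

section \<open>Intermediate points of one sweep\<close>

definition mix :: "real ^ 'n \<Rightarrow> real ^ 'n \<Rightarrow> nat \<Rightarrow> real ^ 'n" where
  "mix x x' i = (\<Sum>j=1..N. P j (if j \<le> i then x' else x))"

lemma mix_0: "mix x x' 0 = x"
proof -
  have "mix x x' 0 = (\<Sum>j=1..N. P j x)"
    unfolding mix_def by (intro sum.cong) auto
  then show ?thesis by (simp only: sum_proj)
qed

lemma mix_N: "mix x x' N = x'"
proof -
  have "mix x x' N = (\<Sum>j=1..N. P j x')"
    unfolding mix_def by (intro sum.cong) auto
  then show ?thesis by (simp only: sum_proj)
qed

text \<open>Rewrites the argument of \<open>f\<close> in the \<open>i\<close>-th subproblem as an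
  affine function of \<open>y\<close>, ready for differentiation.\<close>

lemma assemble_eq_mix:
  assumes "i \<in> {1..N}"
  shows "assemble N d E (\<lambda>j. if j < i then block d E x' j else if j = i then block d E y i
           else block d E x j) = mix x x' i + P i (y - x')"
proof -
  \<comment> \<open>The correction is absorbed by the \<open>i\<close>-th summand, whose
    \<open>P i x'\<close> becomes \<open>P i y\<close>.\<close>
  have "mix x x' i + P i (y - x') =
      (\<Sum>j=1..N. P j (if j \<le> i then x' else x) + (if j = i then P i (y - x') else 0))"
    using assms by (simp add: sum.distrib mix_def)
  also have "\<dots> = (\<Sum>j=1..N. P j (if j < i then x' else if j = i then y else x))"
    by (intro sum.cong) (auto simp: proj_diff)
  finally have "mix x x' i + P i (y - x') = \<dots>" .
  then show ?thesis
    unfolding assemble_def by (auto simp: block_def block_proj_def intro!: sum.cong)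
qed

text \<open>Undoing the \<open>i\<close>-th update leads back to the previous intermediate point;
  this is what makes the descent telescope.\<close>

lemma mix_prev:
  assumes "i \<in> {1..N}"
  shows "mix x x' i + P i (x - x') = mix x x' (i - 1)"
proof -
  have "mix x x' i + P i (x - x') =
      (\<Sum>j=1..N. P j (if j \<le> i then x' else x) + (if j = i then P i (x - x') else 0))"
    using assms by (simp add: sum.distrib mix_def)
  also have "\<dots> = mix x x' (i - 1)"
    unfolding mix_def using assms by (intro sum.cong) (auto simp: proj_diff)
  finally show ?thesis .
qed

lemma norm_mix_le:
  assumes "norm x \<le> b" "norm x' \<le> b"
  shows "norm (mix x x' i) \<le> real N * b"
  unfolding mix_def using assms by (intro norm_sum_proj_le) auto

text \<open>Blockwise, the difference is the projection of either 0 or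
  \<open>x' - x\<close>.\<close>

lemma norm_diff_mix_le: "norm (x' - mix x x' i) \<le> real N * norm (x' - x)"
proof -
  have "x' - mix x x' i = (\<Sum>j=1..N. P j x') - mix x x' i" by (simp only: sum_proj)
  also have "\<dots> = (\<Sum>j=1..N. P j (x' - (if j \<le> i then x' else x)))"
    unfolding mix_def by (simp add: sum_subtractf proj_diff)
  finally have *: "x' - mix x x' i = (\<Sum>j=1..N. P j (x' - (if j \<le> i then x' else x)))" .
  show ?thesis unfolding * by (rule norm_sum_proj_le) auto
qed

section \<open>Consequences of block minimality: finiteness, descent, subgradient\<close>

lemma rccm_step:
  assumes "rccm N d E f g gs M x" and "i \<in> {1..N}"
  shows "ereal (f (mix (x k) (x (Suc k)) i)) + gs i (block d E (x (Suc k)) i)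
           + ereal (M i / 2 * (norm (P i (x (Suc k) - x k)))\<^sup>2)
         \<le> ereal (f (mix (x k) (x (Suc k)) i + P i (y - x (Suc k)))) + gs i (block d E y i)
           + ereal (M i / 2 * (norm (P i (y - x k)))\<^sup>2)"
proof -
  define \<Phi> where "\<Phi> u = ereal (f (assemble N d E
                  (\<lambda>j. if j < i then block d E (x (Suc k)) j
                       else if j = i then u
                       else block d E (x k) j)))
               + gs i u
               + ereal (M i / 2 * (L2_set (\<lambda>j. u j - block d E (x k) i j) {1..d i})\<^sup>2)" for u
  have "is_arg_min \<Phi> (\<lambda>u. u \<in> block_space (d i)) (block d E (x (Suc k)) i)"
    using assms unfolding rccm_def \<Phi>_def by blast
  then have "\<Phi> (block d E (x (Suc k)) i) \<le> \<Phi> (block d E y i)"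
    using block_in_block_space[of d E y i] by (auto simp: is_arg_min_def not_less)
  moreover have "\<Phi> (block d E w i) = ereal (f (mix (x k) (x (Suc k)) i + P i (w - x (Suc k))))
      + gs i (block d E w i) + ereal (M i / 2 * (norm (P i (w - x k)))\<^sup>2)" for w
    unfolding \<Phi>_def by (simp only: assemble_eq_mix[OF assms(2)] L2_set_block_diff[OF assms(2)])
  ultimately show ?thesis
    by (simp add: linear_0[OF linear_block_proj])
qed

text \<open>Induction on \<open>k\<close>: the old block is a competitor of finite value, so the
  minimizing block cannot have value \<open>\<infinity>\<close>. Finiteness turns the
  \<open>ereal\<close> inequalities into real ones.\<close>

lemma rccm_block_finite:
  assumes "rccm N d E f g gs M x" and "structure_assumption N d E f g gs" and "i \<in> {1..N}"
  shows "\<bar>gs i (block d E (x k) i)\<bar> \<noteq> \<infinity>"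
proof -
  have "gs i (block d E (x k) i) \<noteq> \<infinity>"
  proof (induction k)
    case 0
    have "(\<Sum>i=1..N. gs i (block d E (x 0) i)) \<noteq> \<infinity>"
      using assms(1,2) by (auto simp: rccm_def structure_assumption_def)
    \<comment> \<open>A finite \<open>ereal\<close> sum is \<open>\<infinity>\<close> as soon as one
      summand is, so finiteness of the sum passes to each block.\<close>
    then show ?case using assms(3) by (simp only: sum_Pinfty) auto
  next
    case (Suc k)
    then show ?case using rccm_step[OF assms(1,3), of k "x k"] by auto
  qed
  moreover have "gs i (block d E (x k) i) \<noteq> - \<infinity>"
    using assms(2,3) block_in_block_space[of d E "x k" i]
    unfolding structure_assumption_def by blast
  ultimately show ?thesis by auto
qed

lemma rccm_composite_eq:
  assumes "rccm N d E f g gs M x" and "structure_assumption N d E f g gs"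
  shows "composite f g (x k) =
    ereal (f (x k) + (\<Sum>i=1..N. real_of_ereal (gs i (block d E (x k) i))))"
proof -
  have "g (x k) = (\<Sum>i=1..N. gs i (block d E (x k) i))"
    using assms(2) by (simp add: structure_assumption_def)
  also have "\<dots> = (\<Sum>i=1..N. ereal (real_of_ereal (gs i (block d E (x k) i))))"
    by (intro sum.cong refl) (simp add: ereal_real' rccm_block_finite[OF assms])
  finally show ?thesis by (simp add: composite_def)
qed

lemma rccm_descent:
  assumes "rccm N d E f g gs M x" and "structure_assumption N d E f g gs"
    and "\<And>i. i \<in> {1..N} \<Longrightarrow> m \<le> M i"
  shows "composite f g (x (Suc k)) + ereal (m / 2 * (norm (x (Suc k) - x k))\<^sup>2)
         \<le> composite f g (x k)"
proof -
  define z where "z = mix (x k) (x (Suc k))"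
  define c where "c l i = real_of_ereal (gs i (block d E (x l) i))" for l i
  have c: "gs i (block d E (x l) i) = ereal (c l i)" if "i \<in> {1..N}" for l i
    unfolding c_def using rccm_block_finite[OF assms(1,2) that] by (simp add: ereal_real')
  \<comment> \<open>Summed over \<open>i\<close>, the right side telescopes from \<open>x k\<close>
    to \<open>x (Suc k)\<close>, and the \<open>c\<close> terms give the change in
    \<open>g\<close>.\<close>
  have "m / 2 * (norm (P i (x (Suc k) - x k)))\<^sup>2 + c (Suc k) i - c k i \<le> f (z (i - 1)) - f (z i)"
    if "i \<in> {1..N}" for i
  proof -
    have "m / 2 * (norm (P i (x (Suc k) - x k)))\<^sup>2 \<le> M i / 2 * (norm (P i (x (Suc k) - x k)))\<^sup>2"
      using assms(3)[OF that] by (intro mult_right_mono) auto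
    moreover have "f (z i) + c (Suc k) i + M i / 2 * (norm (P i (x (Suc k) - x k)))\<^sup>2
        \<le> f (z (i - 1)) + c k i"
      \<comment> \<open>With the old block as competitor, its proximal term vanishes and
        \<open>f\<close> is evaluated at \<open>z (i - 1)\<close>.\<close>
      using rccm_step[OF assms(1) that, of k "x k"]
      by (simp add: c[OF that] mix_prev[OF that] z_def linear_0[OF linear_block_proj])
    ultimately show ?thesis by linarith
  qed
  then have "(\<Sum>i=1..N. m / 2 * (norm (P i (x (Suc k) - x k)))\<^sup>2 + c (Suc k) i - c k i)
      \<le> (\<Sum>i=1..N. f (z (i - 1)) - f (z i))"
    by (rule sum_mono)
  also have "\<dots> = f (x k) - f (x (Suc k))"
  proof -
    have "(\<Sum>i=1..n. f (z (i - 1)) - f (z i)) = f (z 0) - f (z n)" for n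
      by (induction n) auto
    then show ?thesis by (simp add: z_def mix_0 mix_N)
  qed
  finally have "m / 2 * (norm (x (Suc k) - x k))\<^sup>2 + (\<Sum>i=1..N. c (Suc k) i) - (\<Sum>i=1..N. c k i)
      \<le> f (x k) - f (x (Suc k))"
    by (simp only: sum.distrib sum_subtractf sum_distrib_left[symmetric] sum_norm_proj_squared)
  then show ?thesis
    by (simp add: rccm_composite_eq[OF assms(1,2)] c_def)
qed

lemma rccm_subgradient:
  assumes "rccm N d E f g gs M x" and "structure_assumption N d E f g gs"
    and G: "\<And>y. (f has_derivative (\<lambda>h. G y \<bullet> h)) (at y)"
  defines "z \<equiv> \<lambda>k. mix (x k) (x (Suc k))"
  shows "(\<Sum>i=1..N. P i (G (x (Suc k)) - G (z k i) - M i *\<^sub>R (x (Suc k) - x k)))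
         \<in> frechet_subdifferential (composite f g) (x (Suc k))"
proof -
  let ?x = "x (Suc k)" and ?\<Delta> = "x (Suc k) - x k"
  let ?v = "\<Sum>i=1..N. P i (G ?x - G (z k i) - M i *\<^sub>R ?\<Delta>)"
  \<comment> \<open>\<open>\<phi> i y\<close> is the lower bound for the change in
    \<open>gs i\<close> obtained by solving \<open>rccm_step\<close> for it.\<close>
  define \<phi> where "\<phi> i y = f (z k i) - f (z k i + P i (y - ?x))
    + M i / 2 * ((norm (P i ?\<Delta>))\<^sup>2 - (norm (P i (y - x k)))\<^sup>2)" for i y
  \<comment> \<open>The change in \<open>f\<close> is kept exactly; only the change in
    \<open>g\<close> is replaced by its lower bound.\<close>
  define \<psi> where "\<psi> y = f y - f ?x + (\<Sum>i=1..N. \<phi> i y)" for y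
  have sep: "g y = (\<Sum>i=1..N. gs i (block d E y i))" for y
    using assms(2) by (simp add: structure_assumption_def)
  have fin: "\<bar>composite f g ?x\<bar> \<noteq> \<infinity>"
    by (simp add: rccm_composite_eq[OF assms(1,2)])
  have block_le: "gs i (block d E ?x i) + ereal (\<phi> i y) \<le> gs i (block d E y i)"
    if "i \<in> {1..N}" for i y
    using rccm_step[OF assms(1) that, of k y] rccm_block_finite[OF assms(1,2) that, of "Suc k"]
    by (cases "gs i (block d E ?x i)"; cases "gs i (block d E y i)")
      (auto simp: \<phi>_def z_def algebra_simps)
  have le: "composite f g ?x + ereal (\<psi> y) \<le> composite f g y" for y
  proof -
    have "g ?x + ereal (\<Sum>i=1..N. \<phi> i y) = (\<Sum>i=1..N. gs i (block d E ?x i) + ereal (\<phi> i y))"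
      by (simp add: sep sum.distrib)
    also have "\<dots> \<le> g y" unfolding sep by (intro sum_mono block_le)
    finally show ?thesis
      using fin by (cases "g ?x"; cases "g y") (auto simp: composite_def \<psi>_def)
  qed
  have P_deriv: "((\<lambda>y. P i (y - c)) has_derivative P i) (at ?x)" for i c
    using has_derivative_diff[OF linear_imp_has_derivative[OF linear_block_proj] has_derivative_const]
    by (simp add: proj_diff)
  have f_deriv: "((\<lambda>y. f (z k i + P i (y - ?x))) has_derivative (\<lambda>h. G (z k i) \<bullet> P i h)) (at ?x)" for i
  proof -
    have "((\<lambda>y. z k i + P i (y - ?x)) has_derivative P i) (at ?x)"
      using has_derivative_add[OF has_derivative_const P_deriv] by simp
    moreover have "(f has_derivative (\<lambda>h. G (z k i) \<bullet> h)) (at (z k i + P i (?x - ?x)))"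
      using G by (simp add: linear_0[OF linear_block_proj])
    ultimately show ?thesis by (rule has_derivative_compose)
  qed
  have norm_deriv: "((\<lambda>y. (norm (P i (y - x k)))\<^sup>2) has_derivative (\<lambda>h. 2 * (P i ?\<Delta> \<bullet> P i h))) (at ?x)"
    for i
    using has_derivative_inner[OF P_deriv P_deriv, of i "x k" i "x k"]
    by (simp add: power2_norm_eq_inner inner_commute)
  \<comment> \<open>The zeros are the derivatives of the two constant terms, left in the shape the
    derivative rules produce.\<close>
  have \<phi>_deriv: "(\<phi> i has_derivative (\<lambda>h. 0 - G (z k i) \<bullet> P i h + M i / 2 * (0 - 2 * (P i ?\<Delta> \<bullet> P i h)))) (at ?x)"
    for i
    unfolding \<phi>_def
    by (intro has_derivative_add has_derivative_diff has_derivative_const has_derivative_mult_right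
        f_deriv norm_deriv)
  have "(\<psi> has_derivative (\<lambda>h. G ?x \<bullet> h - 0
      + (\<Sum>i=1..N. 0 - G (z k i) \<bullet> P i h + M i / 2 * (0 - 2 * (P i ?\<Delta> \<bullet> P i h))))) (at ?x)"
    unfolding \<psi>_def
    by (intro has_derivative_add has_derivative_diff has_derivative_const has_derivative_sum \<phi>_deriv G)
  moreover have "G ?x \<bullet> h - 0
      + (\<Sum>i=1..N. 0 - G (z k i) \<bullet> P i h + M i / 2 * (0 - 2 * (P i ?\<Delta> \<bullet> P i h))) = ?v \<bullet> h" for h
  proof -
    \<comment> \<open>Splitting \<open>h\<close> into blocks allows the gradient of \<open>f\<close>
      to be combined with the block terms summand by summand.\<close>
    have "G ?x \<bullet> h = (\<Sum>i=1..N. G ?x \<bullet> P i h)"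
      by (simp only: inner_sum_right[symmetric] sum_proj)
    then have "G ?x \<bullet> h - 0
        + (\<Sum>i=1..N. 0 - G (z k i) \<bullet> P i h + M i / 2 * (0 - 2 * (P i ?\<Delta> \<bullet> P i h)))
      = (\<Sum>i=1..N. G ?x \<bullet> P i h
          + (0 - G (z k i) \<bullet> P i h + M i / 2 * (0 - 2 * (P i ?\<Delta> \<bullet> P i h))))"
      by (simp only: sum.distrib diff_0_right)
    also have "\<dots> = (\<Sum>i=1..N. P i (G ?x - G (z k i) - M i *\<^sub>R ?\<Delta>) \<bullet> h)"
    proof (rule sum.cong)
      fix i assume "i \<in> {1..N}"
      then have "P i ?\<Delta> \<bullet> P i h = ?\<Delta> \<bullet> P i h"
        by (simp only: block_proj_inner proj_idem)
      then show "G ?x \<bullet> P i h + (0 - G (z k i) \<bullet> P i h + M i / 2 * (0 - 2 * (P i ?\<Delta> \<bullet> P i h)))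
          = P i (G ?x - G (z k i) - M i *\<^sub>R ?\<Delta>) \<bullet> h"
        by (simp only: block_proj_inner[of d E i _ h] inner_diff_left inner_scaleR_left)
          (simp add: algebra_simps)
    qed simp
    finally show ?thesis by (simp only: inner_sum_left)
  qed
  moreover have "\<psi> ?x = 0"
    by (simp add: \<psi>_def \<phi>_def linear_0[OF linear_block_proj])
  ultimately show ?thesis
    using frechet_subgradient_of_minorant[where \<psi> = \<psi>, OF fin le] by simp
qed

text \<open>All iterates and intermediate points lie in one ball, so one Lipschitz constant, and
  hence one \<open>C\<close>, serves every \<open>k\<close>.\<close>

lemma rccm_subgradient_bound:
  assumes rccm: "rccm N d E f g gs M x" and str: "structure_assumption N d E f g gs"
    and "bounded (range x)"
  obtains C where "C > 0"
    and "\<And>k. \<exists>v\<in>frechet_subdifferential (composite f g) (x (Suc k)).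
           norm v \<le> C * norm (x (Suc k) - x k)"
proof -
  obtain G H where G: "\<And>y. (f has_derivative (\<lambda>h. G y \<bullet> h)) (at y)"
    and H: "\<And>y. (G has_derivative (\<lambda>h. H y *v h)) (at y)" "continuous_on UNIV H"
    using str by (auto simp: structure_assumption_def twice_continuously_differentiable_def)
  obtain b where b: "b > 0" "\<And>k. norm (x k) \<le> b"
    using assms(3) by (auto simp: bounded_pos)
  \<comment> \<open>The radius covers the iterates, of norm at most \<open>b\<close>, and the
    intermediate points, of norm at most \<open>N * b\<close>.\<close>
  obtain L where L: "L \<ge> 0"
    "\<And>y z. \<lbrakk>norm y \<le> b + real N * b; norm z \<le> b + real N * b\<rbrakk> \<Longrightarrow> norm (G y - G z) \<le> L * norm (y - z)"
    using lipschitz_gradient_on_cball[OF H] by metis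
  have M: "M i \<ge> 0" if "i \<in> {1..N}" for i
    using rccm that by (auto simp: rccm_def)
  \<comment> \<open>The first term is the Lipschitz constant times the factor of
    \<open>norm_diff_mix_le\<close>; the sum dominates every single \<open>M i\<close>.\<close>
  define A where "A = L * real N + (\<Sum>i=1..N. M i)"
  have A: "A \<ge> 0" using L(1) M by (auto simp: A_def intro!: add_nonneg_nonneg sum_nonneg)
  \<comment> \<open>Adding 1 makes the constant positive even when \<open>A = 0\<close>.\<close>
  have "\<exists>v\<in>frechet_subdifferential (composite f g) (x (Suc k)).
           norm v \<le> (real N * A + 1) * norm (x (Suc k) - x k)" for k
  proof (intro bexI[OF _ rccm_subgradient[OF rccm str G]])
    define z where "z = mix (x k) (x (Suc k))"
    let ?\<Delta> = "x (Suc k) - x k"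
    have "norm (G (x (Suc k)) - G (z i) - M i *\<^sub>R ?\<Delta>) \<le> A * norm ?\<Delta>" if "i \<in> {1..N}" for i
    proof -
      have "norm (x (Suc k)) \<le> b + real N * b" "norm (z i) \<le> b + real N * b"
        using b b(2)[of "Suc k"] norm_mix_le[of "x k" b "x (Suc k)" i]
        unfolding z_def by (auto intro: add_increasing add_increasing2)
      then have "norm (G (x (Suc k)) - G (z i)) \<le> L * norm (x (Suc k) - z i)"
        by (rule L(2))
      also have "\<dots> \<le> L * (real N * norm ?\<Delta>)"
        unfolding z_def using L(1) by (intro mult_left_mono norm_diff_mix_le)
      finally have "norm (G (x (Suc k)) - G (z i)) \<le> L * real N * norm ?\<Delta>" by simp
      moreover have "norm (M i *\<^sub>R ?\<Delta>) \<le> (\<Sum>i=1..N. M i) * norm ?\<Delta>"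
        using that M by (auto intro!: mult_right_mono member_le_sum)
      ultimately show ?thesis
        using norm_triangle_ineq4[of "G (x (Suc k)) - G (z i)" "M i *\<^sub>R ?\<Delta>"]
        by (simp add: A_def distrib_right)
    qed
    then have "norm (\<Sum>i=1..N. P i (G (x (Suc k)) - G (z i) - M i *\<^sub>R ?\<Delta>))
        \<le> real N * (A * norm ?\<Delta>)"
      by (rule norm_sum_proj_le)
    also have "\<dots> \<le> (real N * A + 1) * norm ?\<Delta>"
      by (simp add: distrib_right)
    finally show "norm (\<Sum>i=1..N. P i (G (x (Suc k)) - G (mix (x k) (x (Suc k)) i) - M i *\<^sub>R ?\<Delta>))
        \<le> (real N * A + 1) * norm ?\<Delta>"
      by (simp only: z_def)
  qed
  then show ?thesis using that[of "real N * A + 1"] A by (simp add: add_nonneg_pos)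
qed

end

section \<open>Attained minima and the final estimate\<close>

lemma closed_norm_arg_min_exists:
  fixes S :: "'a::euclidean_space set"
  assumes "closed S" "S \<noteq> {}"
  obtains s where "is_arg_min norm (\<lambda>t. t \<in> S) s" "infdist 0 S = norm s"
proof -
  obtain s where "s \<in> S" "infdist 0 S = dist 0 s"
    using infdist_attains_inf[OF assms] by blast
  moreover have "infdist 0 S \<le> norm t" if "t \<in> S" for t
    using infdist_le[OF that, of 0] by simp
  ultimately show ?thesis
    by (intro that[of s]) (auto simp: is_arg_min_def not_less)
qed

text \<open>The infimum is the value at a minimizer, finite by properness. Subtracting
  \<open>Fopt\<close> is then ordinary real subtraction.\<close>

lemma composite_INF_finite:
  assumes "proper g" and "has_minimizer (composite f g)"
  shows "\<bar>INF z. composite f g z\<bar> \<noteq> \<infinity>"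
proof -
  obtain z where z: "\<And>y. composite f g z \<le> composite f g y"
    using assms(2) by (auto simp: has_minimizer_def is_arg_min_def not_less)
  then have "(INF y. composite f g y) = composite f g z"
    by (intro antisym INF_lower INF_greatest) auto
  moreover obtain y where "g y \<noteq> \<infinity>"
    using assms(1) by (auto simp: proper_def)
  then have "composite f g z \<noteq> \<infinity>"
    using z[of y] by (auto simp: composite_def)
  moreover have "composite f g z \<noteq> - \<infinity>"
    using assms(1) by (auto simp: composite_def proper_def)
  ultimately show ?thesis by auto
qed

theorem theorem2:
  fixes N :: nat and d :: "nat \<Rightarrow> nat" and E :: "nat \<Rightarrow> nat \<Rightarrow> real ^ 'n"
    and f :: "real ^ 'n \<Rightarrow> real" and g :: "real ^ 'n \<Rightarrow> ereal"
    and gs :: "nat \<Rightarrow> (nat \<Rightarrow> real) \<Rightarrow> ereal"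
    and M :: "nat \<Rightarrow> real" and x :: "nat \<Rightarrow> real ^ 'n"
    and X :: "(real ^ 'n) set" and Fs \<sigma> q \<gamma> \<epsilon> :: real and k0 :: nat
    and F :: "real ^ 'n \<Rightarrow> ereal" and Fopt :: ereal and Mmin :: real
  assumes "F = composite f g"
    and "Fopt = (INF z. F z)"
    and "Mmin = Min (M ` {1..N})"
    and "block_partition N d E"
    and "structure_assumption N d E f g gs"
    and "has_minimizer F"
    and "rccm N d E f g gs M x"
    and "bounded (range x)"
    and "compact X" and "X \<noteq> {}" and "\<forall>z\<in>X. F z = ereal Fs"
    and "\<sigma> > 0" and "q > 1" and "\<gamma> > 0" and "\<epsilon> > 0"
    and "KL_property F X Fs \<sigma> q \<gamma> \<epsilon>"
    and "\<forall>k\<ge>k0. infdist (x k) X \<le> \<gamma> \<and> ereal Fs < F (x k) \<and> F (x k) < ereal (Fs + \<epsilon>)"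
  shows "\<exists>C>0.
    (\<forall>k. \<exists>s. is_arg_min norm (\<lambda>t. t \<in> limiting_subdifferential F (x (Suc k))) s \<and>
             norm s \<le> C * norm (x (Suc k) - x k)) \<and>
    (\<forall>k\<ge>k0. F (x (Suc k)) - Fopt \<le>
       (F (x k) - Fopt)
         - ereal (Mmin / (2 * C\<^sup>2) *
                  ((real_of_ereal (F (x (Suc k))) - Fs) / \<sigma>) powr (2 / q)))"
proof -
  interpret partitioned_space N d E by unfold_locales fact
  note rccm = assms(7) and str = assms(5) and F = assms(1)
  \<comment> \<open>Ensures that \<open>Mmin\<close> is the minimum of a nonempty set, which its
    nonnegativity rests on.\<close>
  have N: "N \<noteq> 0"
  proof
    assume "N = 0"
    then have "(Basis :: (real ^ 'n) set) = {}"
      using bij_Basis by (simp add: bij_betw_def)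
    then show False by simp
  qed
  have Mmin_le: "Mmin \<le> M i" if "i \<in> {1..N}" for i
    using that assms(3) by simp
  have Mmin_nonneg: "Mmin \<ge> 0"
    using N rccm assms(3) by (simp add: rccm_def)
  obtain C where C: "C > 0"
    "\<And>k. \<exists>v\<in>frechet_subdifferential F (x (Suc k)). norm v \<le> C * norm (x (Suc k) - x k)"
    using rccm_subgradient_bound[OF rccm str assms(8)] F by metis
  \<comment> \<open>The Frechet subgradient shows that the closed limiting subdifferential is
    nonempty and bounds its least norm, which is also the distance in the KL inequality.\<close>
  have min_subgradient: "\<exists>s. is_arg_min norm (\<lambda>t. t \<in> limiting_subdifferential F (x (Suc k))) s \<and>
      infdist 0 (limiting_subdifferential F (x (Suc k))) = norm s \<and>
      norm s \<le> C * norm (x (Suc k) - x k)" for k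
  proof -
    obtain v where v: "v \<in> limiting_subdifferential F (x (Suc k))"
      "norm v \<le> C * norm (x (Suc k) - x k)"
      using C(2) frechet_subset_limiting_subdifferential by blast
    then obtain s where s: "is_arg_min norm (\<lambda>t. t \<in> limiting_subdifferential F (x (Suc k))) s"
      "infdist 0 (limiting_subdifferential F (x (Suc k))) = norm s"
      using closed_norm_arg_min_exists[OF closed_limiting_subdifferential] by (metis empty_iff)
    moreover have "norm s \<le> norm v"
      using s(1) v(1) by (auto simp: is_arg_min_def not_less)
    ultimately show ?thesis using v(2) by (meson order_trans)
  qed
  have "F (x (Suc k)) - Fopt \<le> (F (x k) - Fopt)
      - ereal (Mmin / (2 * C\<^sup>2) * ((real_of_ereal (F (x (Suc k))) - Fs) / \<sigma>) powr (2 / q))"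
    if "k \<ge> k0" for k
  proof -
    obtain a b where ab: "F (x k) = ereal a" "F (x (Suc k)) = ereal b"
      using rccm_composite_eq[OF rccm str] F by blast
    obtain p where p: "Fopt = ereal p"
      using composite_INF_finite[of g f] assms(1,2,6) str
      by (auto simp: structure_assumption_def)
    obtain s where s: "s \<in> limiting_subdifferential F (x (Suc k))"
      "infdist 0 (limiting_subdifferential F (x (Suc k))) = norm s"
      "norm s \<le> C * norm (x (Suc k) - x k)"
      using min_subgradient[of k] by (auto simp: is_arg_min_def)
    \<comment> \<open>KL is applied at the new iterate, whose index \<open>Suc k\<close> is still at
      least \<open>k0\<close>.\<close>
    have nbhd: "infdist (x (Suc k)) X \<le> \<gamma>" "ereal Fs < F (x (Suc k))"
      "F (x (Suc k)) < ereal (Fs + \<epsilon>)"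
      using assms(17) that by auto
    then have "F (x (Suc k)) - ereal Fs
        \<le> ereal (\<sigma> * infdist 0 (limiting_subdifferential F (x (Suc k))) powr q)"
      using assms(16) s(1) unfolding KL_property_def by blast
    then have "b - Fs \<le> \<sigma> * norm s powr q"
      by (simp add: ab s(2))
    also have "\<dots> \<le> \<sigma> * (C * norm (x (Suc k) - x k)) powr q"
      using s(3) assms(12,13) by (intro mult_left_mono powr_mono2) auto
    finally have KL: "(b - Fs) / \<sigma> \<le> (C * norm (x (Suc k) - x k)) powr q"
      using assms(12) by (simp add: pos_divide_le_eq mult.commute)
    have "b > Fs" using nbhd(2) by (simp add: ab)
    \<comment> \<open>Positivity of \<open>b - Fs\<close> makes raising to the power
      \<open>2 / q\<close> monotone; the exponent \<open>q\<close> then cancels to leave a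
      square.\<close>
    then have "((b - Fs) / \<sigma>) powr (2 / q) \<le> ((C * norm (x (Suc k) - x k)) powr q) powr (2 / q)"
      using assms(12,13) KL by (intro powr_mono2) auto
    also have "\<dots> = (C * norm (x (Suc k) - x k)) powr 2"
      using assms(13) by (simp add: powr_powr)
    also have "\<dots> = C\<^sup>2 * (norm (x (Suc k) - x k))\<^sup>2"
      using C(1) by (simp add: power_mult_distrib)
    finally have "Mmin / (2 * C\<^sup>2) * ((b - Fs) / \<sigma>) powr (2 / q)
        \<le> Mmin / (2 * C\<^sup>2) * (C\<^sup>2 * (norm (x (Suc k) - x k))\<^sup>2)"
      using Mmin_nonneg by (intro mult_left_mono) auto
    also have "\<dots> = Mmin / 2 * (norm (x (Suc k) - x k))\<^sup>2"
      using C(1) by simp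
    also have "\<dots> \<le> a - b"
      using rccm_descent[OF rccm str Mmin_le, of k] ab F by (simp add: algebra_simps)
    finally show ?thesis by (simp add: ab p)
  qed
  then show ?thesis using C(1) min_subgradient by blast
qed

end
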